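(* There is a constant $c>0$ such that for all sufficiently large $n$, \[ \mathit{Gap}_{+/\lor}(n)\;=\;\max_{A\in\{0,1\}^{n\times n}} \frac{C_{+}(A)}{C_{\lor}(A)} \;\ge\; c\,\frac{n^{1/2}}{\log^2 n}, \] i.e. $\mathit{Gap}_{+/\lor}(n)=\Omega(n^{1/2}/\log^2 n)$.
   Context: A circuit is a directed acyclic graph whose in-degree-zero vertices are input gates $x_1,\dots,x_n$ and whose other vertices are arithmetic gates of unbounded fan-in; some gates are designated output gates $y_1,\dots,y_m$. The size of a circuit is its number of wires (edges). For a boolean $m\times n$ matrix $A=(a_{ij})$: an OR-circuit computes $A$ if, when each gate computes the boolean OR of its children, each output computes $y_i=\bigvee_j a_{ij}x_j$ (as a formal linear form over the boolean semiring $(\{0,1\},\lor,\land)$); a SUM-circuit computes $A$ if, when each gate computes the integer sum of its children, each output computes the formal linear form $y_i=\sum_j a_{ij}x_j$ over the non-negative integers (equivalently, there is exactly one directed path from $x_j$ to $y_i$ if $a_{ij}=1$ and none otherwise); an XOR-circuit computes $A$ if, with gates computing sums modulo 2, $y_i=\sum_j a_{ij}x_j$ over $\mathrm{GF}(2)$. $C_\lor(A)$, $C_+(A)$, $C_\oplus(A)$ denote the minimum size of an OR-, SUM-, XOR-circuit computing $A$. For $X,Y\in\{\lor,+,\oplus\}$, $\mathit{Gap}_{X/Y}(n)=\max_{A\in\{0,1\}^{n\times n}} C_X(A)/C_Y(A)$. Logarithms are base 2. *)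

theory Defs
  imports
    Complex_Main
    "HOL-Library.Z2"
    "Jordan_Normal_Form.Matrix"
begin

(* Gates are natural numbers; this loses no generality, since circuits are finite. *)
record circuit =
  gates :: "nat set"
  wires :: "(nat \<times> nat) set"
  inp :: "nat \<Rightarrow> nat"
  out :: "nat \<Rightarrow> nat"

definition children :: "circuit \<Rightarrow> nat \<Rightarrow> nat set" where
  "children \<Gamma> v = {u. (u, v) \<in> wires \<Gamma>}"

(* The inputs x_1, ..., x_n and outputs y_1, ..., y_m are indexed from 0. The input gates are
   exactly the gates of in-degree zero, so every arithmetic gate has a child. Any gate may be
   designated as an output, and one gate may serve several outputs. *)
definition is_circuit :: "nat \<Rightarrow> nat \<Rightarrow> circuit \<Rightarrow> bool" where
  "is_circuit m n \<Gamma> \<longleftrightarrow>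
     finite (gates \<Gamma>) \<and> wires \<Gamma> \<subseteq> gates \<Gamma> \<times> gates \<Gamma> \<and> acyclic (wires \<Gamma>) \<and>
     bij_betw (inp \<Gamma>) {..<n} {v \<in> gates \<Gamma>. children \<Gamma> v = {}} \<and>
     out \<Gamma> \<in> {..<m} \<rightarrow> gates \<Gamma>"

definition circuit_size :: "circuit \<Rightarrow> nat" where
  "circuit_size \<Gamma> = card (wires \<Gamma>)"

(* The linear form computed at gate v is represented by its coefficients: f v k is the
   coefficient of x_k. The argument emb maps the boolean constants to 0 and 1 of the coefficient
   semiring, and add_over g S is the semiring sum of g over the finite set S. As wires are acyclic,
   these equations determine f v k for all gates v and all k < n. *)
definition gate_forms ::
  "(bool \<Rightarrow> 'a) \<Rightarrow> ((nat \<Rightarrow> 'a) \<Rightarrow> nat set \<Rightarrow> 'a) \<Rightarrow> nat \<Rightarrow> circuit \<Rightarrow> (nat \<Rightarrow> nat \<Rightarrow> 'a) \<Rightarrow> bool" where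
  "gate_forms emb add_over n \<Gamma> f \<longleftrightarrow>
     (\<forall>j<n. \<forall>k<n. f (inp \<Gamma> j) k = emb (j = k)) \<and>
     (\<forall>v\<in>gates \<Gamma>. children \<Gamma> v \<noteq> {} \<longrightarrow>
        (\<forall>k<n. f v k = add_over (\<lambda>u. f u k) (children \<Gamma> v)))"

definition computes_over ::
  "(bool \<Rightarrow> 'a) \<Rightarrow> ((nat \<Rightarrow> 'a) \<Rightarrow> nat set \<Rightarrow> 'a) \<Rightarrow> circuit \<Rightarrow> bool mat \<Rightarrow> bool" where
  "computes_over emb add_over \<Gamma> A \<longleftrightarrow>
     is_circuit (dim_row A) (dim_col A) \<Gamma> \<and>
     (\<exists>f. gate_forms emb add_over (dim_col A) \<Gamma> f \<and>
          (\<forall>i<dim_row A. \<forall>j<dim_col A. f (out \<Gamma> i) j = emb (A $$ (i, j))))"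

datatype gate_model = OR_gate | SUM_gate | XOR_gate

(* The type bit is the field GF(2). *)
fun computes :: "gate_model \<Rightarrow> circuit \<Rightarrow> bool mat \<Rightarrow> bool" where
  "computes OR_gate \<Gamma> A = computes_over (\<lambda>b. b) (\<lambda>g S. \<exists>u\<in>S. g u) \<Gamma> A"
| "computes SUM_gate \<Gamma> A = computes_over (of_bool :: bool \<Rightarrow> nat) sum \<Gamma> A"
| "computes XOR_gate \<Gamma> A = computes_over (of_bool :: bool \<Rightarrow> bit) sum \<Gamma> A"

definition computable :: "gate_model \<Rightarrow> bool mat \<Rightarrow> bool" where
  "computable X A \<longleftrightarrow> (\<exists>\<Gamma>. computes X \<Gamma> A)"

(* Meaningful only for computable matrices: a zero row cannot be computed by an OR- or a
   SUM-circuit. *)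
definition complexity :: "gate_model \<Rightarrow> bool mat \<Rightarrow> nat" where
  "complexity X A = (LEAST s. \<exists>\<Gamma>. computes X \<Gamma> A \<and> circuit_size \<Gamma> = s)"

(* The maximum is taken over the matrices for which the ratio is defined. The denominator
   vanishes only when every output can be placed on an input gate. *)
definition Gap :: "gate_model \<Rightarrow> gate_model \<Rightarrow> nat \<Rightarrow> real" where
  "Gap X Y n = Max {real (complexity X A) / real (complexity Y A) | A.
     A \<in> carrier_mat n n \<and> computable X A \<and> computable Y A \<and> complexity Y A > 0}"

end

theory Submission
  imports Defs
begin

text \<open>
  Take \<open>N = 4 ^ h\<close> and a dense \<open>N \<times> N\<close> matrix \<open>M\<close> without all-ones submatrices having more than
  \<open>K = 4 h\<close> rows and columns (a counting argument provides one), and consider the Kronecker product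
  of \<open>J - I\<close> with \<open>M\<close>, where \<open>J\<close> is the all-ones \<open>N \<times> N\<close> matrix.

  The matrix \<open>J - I\<close> has boolean rank \<open>O(log N)\<close>: two distinct indices differ in some binary digit.
  So an OR-circuit needs only \<open>O(log N)\<close> copies of a circuit for \<open>M\<close>, and each of them costs
  \<open>O(N\<^sup>2 / log N)\<close> by Lupanov's method of tabulating the unions within blocks of \<open>h\<close> columns. The total is
  \<open>O(N\<^sup>2)\<close>.

  In a SUM-circuit call a gate light if the inputs it depends on meet at most \<open>K\<close> columns of \<open>M\<close>. A wire
  from a light to a heavy gate serves at most \<open>K\<^sup>2\<close> entries of \<open>M\<close>. For each nonzero entry of \<open>M\<close>, the forms
  carried by the wires serving it, together with those of the light outputs, span the rows of
  \<open>J - I\<close>, so at least \<open>N - 1\<close> of them are needed. Summing over the entries of \<open>M\<close> gives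
  \<open>\<Omega>(N\<^sup>3 / log\<^sup>2 N)\<close> wires.
\<close>

section \<open>Linear algebra: homogeneous systems with fewer equations than unknowns\<close>

text \<open>Gaussian elimination: an equation with a nonzero coefficient at \<open>k\<close> is used
  to eliminate the unknown \<open>k\<close> from all others. The SUM lower bound uses this as its
  rank argument.\<close>

lemma underdetermined_system:
  fixes B :: "('a \<Rightarrow> real) set"
  assumes "finite B" "finite J" "card B < card J"
  shows "\<exists>x. (\<exists>j\<in>J. x j \<noteq> 0) \<and> (\<forall>b\<in>B. (\<Sum>j\<in>J. b j * x j) = 0)"
proof -
  \<comment> \<open>The induction runs over an upper bound \<open>m\<close> of
    \<open>card B\<close>, because distinct equations may coincide after elimination.\<close>
  have "\<exists>x. (\<exists>j\<in>J. x j \<noteq> 0) \<and> (\<forall>b\<in>B. (\<Sum>j\<in>J. b j * x j) = 0)"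
    if "finite B" "finite J" "card B \<le> m" "m < card J" for m and B :: "('a \<Rightarrow> real) set" and J
    using that
  proof (induction m arbitrary: B J)
    case 0
    then have "B = {}" by simp
    moreover obtain j where "j \<in> J" using 0 by fastforce
    ultimately show ?case by (intro exI[of _ "\<lambda>_. 1"]) auto
  next
    case (Suc m)
    show ?case
    proof (cases "\<forall>b\<in>B. \<forall>j\<in>J. b j = 0")
      case True
      moreover obtain j where "j \<in> J" using Suc.prems by fastforce
      ultimately show ?thesis by (intro exI[of _ "\<lambda>_. 1"]) auto
    next
      case False
      then obtain b k where k: "b \<in> B" "k \<in> J" "b k \<noteq> 0" by blast
      define red where "red a = (\<lambda>j. a j - a k / b k * b j)" for a
      have "card (B - {b}) \<le> m" using Suc.prems k by simp
      then have "card (red ` (B - {b})) \<le> m"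
        using card_image_le[of "B - {b}" red] Suc.prems by simp
      moreover have "card (J - {k}) = card J - 1" using k Suc.prems by simp
      ultimately have "\<exists>x. (\<exists>j\<in>J - {k}. x j \<noteq> 0) \<and>
          (\<forall>a\<in>red ` (B - {b}). (\<Sum>j\<in>J - {k}. a j * x j) = 0)"
        using Suc.prems by (intro Suc.IH) auto
      then obtain x where x: "\<exists>j\<in>J - {k}. x j \<noteq> 0"
        "\<And>a. a \<in> B - {b} \<Longrightarrow> (\<Sum>j\<in>J - {k}. red a j * x j) = 0" by blast
      define s where "s = (\<Sum>j\<in>J - {k}. b j * x j)"
      \<comment> \<open>Back substitution: the value at \<open>k\<close> solves equation
        \<open>b\<close>, and by \<open>split\<close> every other equation then reduces to its
        \<open>red\<close> form.\<close>
      define y where "y = x(k := - s / b k)"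
      have split: "(\<Sum>j\<in>J. a j * y j) = a k * (- s / b k) + (\<Sum>j\<in>J - {k}. a j * x j)" for a
      proof -
        have "(\<Sum>j\<in>J - {k}. a j * y j) = (\<Sum>j\<in>J - {k}. a j * x j)"
          by (intro sum.cong) (auto simp: y_def)
        then show ?thesis using k Suc.prems by (simp add: sum.remove[of J k] y_def)
      qed
      have "(\<Sum>j\<in>J. a j * y j) = 0" if a: "a \<in> B" for a
      proof (cases "a = b")
        case True
        then show ?thesis using k unfolding split by (simp add: s_def)
      next
        case False
        then have "(\<Sum>j\<in>J - {k}. red a j * x j) = 0" using a x(2) by auto
        moreover have "(\<Sum>j\<in>J - {k}. red a j * x j) = (\<Sum>j\<in>J - {k}. a j * x j) - a k / b k * s"
          unfolding red_def s_def sum_distrib_left sum_subtractf[symmetric]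
          by (intro sum.cong) (auto simp: algebra_simps)
        ultimately show ?thesis unfolding split by simp
      qed
      moreover have "\<exists>j\<in>J. y j \<noteq> 0" using x(1) by (auto simp: y_def)
      ultimately show ?thesis by blast
    qed
  qed
  then show ?thesis using assms by blast
qed

section \<open>Counting: dense relations without large rectangles\<close>

lemma card_supersets:
  assumes "finite \<Omega>" "P \<subseteq> \<Omega>"
  shows "card {M. P \<subseteq> M \<and> M \<subseteq> \<Omega>} = 2 ^ (card \<Omega> - card P)"
proof -
  have "bij_betw (\<lambda>M. M \<union> P) (Pow (\<Omega> - P)) {M. P \<subseteq> M \<and> M \<subseteq> \<Omega>}"
    using assms by (intro bij_betw_byWitness[where f' = "\<lambda>M. M - P"]) auto
  then show ?thesis
    using assms by (metis bij_betw_same_card card_Pow card_Diff_subset finite_Diff finite_subset)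
qed

text \<open>With \<open>k = 4 * h + 1\<close> there are at most \<open>2 ^ (4 * h * k)\<close>
  squares of side \<open>k\<close>, and each is contained in \<open>2 ^ (N * N - k * k)\<close>
  relations. As \<open>k * k\<close> exceeds \<open>4 * h * k\<close> by \<open>k\<close>, fewer
  than half of all relations contain such a square, while at least half of them are dense.\<close>

lemma exists_dense_rectangle_free:
  fixes h :: nat
  assumes "h > 0"
  defines "N \<equiv> 4 ^ h"
  shows "\<exists>M. M \<subseteq> {..<N} \<times> {..<N} \<and> N * N \<le> 2 * card M \<and>
    (\<forall>R C. R \<times> C \<subseteq> M \<longrightarrow> card R \<le> 4 * h \<or> card C \<le> 4 * h)"
proof -
  define k where "k = 4 * h + 1"
  define \<Omega> where "\<Omega> = {..<N} \<times> {..<N}"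
  define \<K> where "\<K> = {R. R \<subseteq> {..<N} \<and> card R = k}"
  define bad where "bad = (\<Union>(R, C)\<in>\<K> \<times> \<K>. {M. R \<times> C \<subseteq> M \<and> M \<subseteq> \<Omega>})"
  define dense where "dense = {M. M \<subseteq> \<Omega> \<and> N * N \<le> 2 * card M}"
  have fin: "finite \<Omega>" "card \<Omega> = N * N" "finite \<K>"
    by (auto simp: \<Omega>_def \<K>_def card_cartesian_product)
  \<comment> \<open>This keeps the truncated subtraction \<open>N * N - k * k\<close> exact. The
    assumption can fail for small \<open>h\<close>: for \<open>h = 1\<close> one has
    \<open>N = 4\<close> and \<open>k = 5\<close>.\<close>
  have "k * k \<le> N * N" if "\<K> \<noteq> {}"
  proof -
    obtain R where "R \<subseteq> {..<N}" "card R = k" using \<open>\<K> \<noteq> {}\<close> by (auto simp: \<K>_def)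
    then have "k \<le> N" by (metis card_lessThan card_mono finite_lessThan)
    then show ?thesis by (intro mult_le_mono)
  qed
  have cK: "card \<K> \<le> 2 ^ (2 * h * k)"
  proof -
    have "card \<K> = N choose k" using n_subsets[of "{..<N}" k] by (simp add: \<K>_def)
    also have "\<dots> \<le> N ^ k"
      by (cases "k \<le> N") (simp_all add: binomial_le_pow binomial_eq_0)
    also have "\<dots> = 2 ^ (2 * h * k)"
      by (simp add: N_def power_mult flip: power_mult) (simp add: power_mult)
    finally show ?thesis .
  qed
  have bad: "2 * card bad < 2 ^ (N * N)"
  proof (cases "\<K> = {}")
    case True
    then show ?thesis by (simp add: bad_def)
  next
    case False
    then have kN: "k * k \<le> N * N" by fact
    have "card bad \<le> (\<Sum>(R, C)\<in>\<K> \<times> \<K>. card {M. R \<times> C \<subseteq> M \<and> M \<subseteq> \<Omega>})"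
      unfolding bad_def using fin(3) by (intro order_trans[OF card_UN_le]) (auto simp: case_prod_beta)
    also have "\<dots> = (\<Sum>(R, C)\<in>\<K> \<times> \<K>. 2 ^ (N * N - k * k))"
    proof (intro sum.cong refl, clarsimp)
      fix R C assume "R \<in> \<K>" "C \<in> \<K>"
      then show "card {M. R \<times> C \<subseteq> M \<and> M \<subseteq> \<Omega>} = 2 ^ (N * N - k * k)"
        using card_supersets[OF fin(1), of "R \<times> C"] fin(2)
        by (auto simp: \<K>_def \<Omega>_def card_cartesian_product)
    qed
    also have "\<dots> = card \<K> * card \<K> * 2 ^ (N * N - k * k)"
      by (simp add: card_cartesian_product case_prod_beta)
    also have "\<dots> \<le> 2 ^ (2 * h * k) * 2 ^ (2 * h * k) * 2 ^ (N * N - k * k)"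
      using cK by (intro mult_le_mono) auto
    also have "\<dots> = 2 ^ (4 * h * k + (N * N - k * k))"
      by (simp flip: power_add)
    finally have "2 * card bad \<le> 2 ^ Suc (4 * h * k + (N * N - k * k))" by simp
    also have "Suc (4 * h * k + (N * N - k * k)) < N * N"
    proof -
      have "k * k = 4 * h * k + k" by (simp add: k_def algebra_simps)
      moreover have "k > 1" using assms by (simp add: k_def)
      ultimately show ?thesis using kN by linarith
    qed
    then have "(2::nat) ^ Suc (4 * h * k + (N * N - k * k)) < 2 ^ (N * N)"
      by (intro power_strict_increasing) auto
    finally show ?thesis .
  qed
  have "2 ^ (N * N) \<le> 2 * card dense"
  proof -
    have fd: "finite dense" using fin(1) by (simp add: dense_def)
    \<comment> \<open>Complementation injects the relations with fewer than half of the pairs into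
      those with at least half.\<close>
    have "(\<lambda>M. \<Omega> - M) ` (Pow \<Omega> - dense) \<subseteq> dense"
    proof clarsimp
      fix M assume "M \<subseteq> \<Omega>" "M \<notin> dense"
      moreover from this have "card (\<Omega> - M) = N * N - card M"
        using fin by (metis card_Diff_subset finite_subset)
      ultimately show "\<Omega> - M \<in> dense" by (auto simp: dense_def)
    qed
    moreover have "inj_on (\<lambda>M. \<Omega> - M) (Pow \<Omega> - dense)" by (auto simp: inj_on_def)
    ultimately have "card (Pow \<Omega> - dense) \<le> card dense"
      using fd card_inj_on_le by blast
    moreover have "card (Pow \<Omega> - dense) = card (Pow \<Omega>) - card dense"
      using fd by (intro card_Diff_subset) (auto simp: dense_def)
    ultimately show ?thesis using fin by (simp add: card_Pow)
  qed
  with bad have "card bad < card dense" by simp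
  moreover have "finite bad"
    using fin unfolding bad_def by (auto intro: rev_finite_subset[of "Pow \<Omega>"])
  ultimately obtain M where M: "M \<in> dense" "M \<notin> bad"
    by (metis card_mono linorder_not_less subsetI)
  have "card R \<le> 4 * h \<or> card C \<le> 4 * h" if RC: "R \<times> C \<subseteq> M" for R C
  proof (rule ccontr)
    assume "\<not> ?thesis"
    then have "k \<le> card R" "k \<le> card C" by (auto simp: k_def)
    then obtain R' C' where *: "R' \<subseteq> R" "card R' = k" "C' \<subseteq> C" "card C' = k"
      by (meson obtain_subset_with_card_n)
    moreover have "R' \<noteq> {}" "C' \<noteq> {}" using * by (auto simp: k_def)
    moreover have "R' \<times> C' \<subseteq> \<Omega>" using RC * M by (auto simp: dense_def)
    ultimately have "R' \<in> \<K>" "C' \<in> \<K>" by (auto simp: \<K>_def \<Omega>_def)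
    moreover have "R' \<times> C' \<subseteq> M" using RC * by auto
    ultimately show False using M by (auto simp: bad_def dense_def)
  qed
  then show ?thesis using M by (intro exI[of _ M]) (auto simp: dense_def \<Omega>_def)
qed

text \<open>
  Row \<open>i * N + p\<close> and column \<open>j * N + q\<close> stand for the pairs \<open>(i, p)\<close> and \<open>(j, q)\<close>. The all-ones last
  column keeps the rows nonzero, as computability requires.
\<close>

definition gap_matrix :: "nat \<Rightarrow> nat \<Rightarrow> (nat \<times> nat) set \<Rightarrow> bool mat" where
  "gap_matrix n N M = mat n n (\<lambda>(r, c). c = n - 1 \<or>
     r < N * N \<and> c < N * N \<and> r div N \<noteq> c div N \<and> (r mod N, c mod N) \<in> M)"

subsection \<open>OR-circuits\<close>

text \<open>
  A gate is identified with the set of inputs it depends on. Wires lead from proper subsets to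
  supersets, which makes acyclicity automatic; the empty set stands for gates to be discarded.
\<close>

definition or_computable :: "nat \<Rightarrow> nat set set \<Rightarrow> nat \<Rightarrow> bool" where
  "or_computable n G k \<longleftrightarrow> (\<exists>F E. G \<subseteq> F \<and> finite F \<and> F \<subseteq> Pow {..<n} \<and> (\<forall>c<n. {c} \<in> F) \<and>
     E \<subseteq> {(u, v) \<in> F \<times> F. u \<noteq> {} \<and> u \<subset> v} \<and> card E \<le> k \<and>
     (\<forall>v\<in>F. v = {} \<or> (\<exists>c. v = {c}) \<or> v = \<Union>{u. (u, v) \<in> E}))"

lemma or_computable_singletons: "or_computable n ((\<lambda>c. {c}) ` {..<n}) 0"
  unfolding or_computable_def
proof (intro exI conjI)
  show "(\<lambda>c. {c}) ` {..<n} \<subseteq> (\<lambda>c. {c}) ` {..<n}" "finite ((\<lambda>c. {c}) ` {..<n})" by simp_all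
qed auto

text \<open>Adds one layer of gates. A union already present is reused at no cost; a union not in
  \<open>F\<close> differs from all its children, so the new wires lead from proper subsets. Indices
  with the same union share one gate, which takes the wires of all of them.\<close>

lemma or_computable_unions:
  assumes "or_computable n G k" "finite I"
    and ch: "\<And>i. i \<in> I \<Longrightarrow> ch i \<subseteq> G \<union> (\<lambda>c. {c}) ` {..<n}"
    and card_ch: "\<And>i. i \<in> I \<Longrightarrow> card (ch i) \<le> d"
    and g: "\<And>i. i \<in> I \<Longrightarrow> g i = \<Union>(ch i)"
  shows "or_computable n (g ` I) (k + card I * d)"
proof -
  obtain F E where F: "G \<subseteq> F" "finite F" "F \<subseteq> Pow {..<n}" "\<And>c. c < n \<Longrightarrow> {c} \<in> F"
    and E: "E \<subseteq> {(u, v) \<in> F \<times> F. u \<noteq> {} \<and> u \<subset> v}" "card E \<le> k"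
    and eq: "\<And>v. v \<in> F \<Longrightarrow> v = {} \<or> (\<exists>c. v = {c}) \<or> v = \<Union>{u. (u, v) \<in> E}"
    using assms(1) unfolding or_computable_def by auto
  have chF: "ch i \<subseteq> F" if "i \<in> I" for i using ch[OF that] F by auto
  define J where "J = {i \<in> I. g i \<notin> F}"
  define E' where "E' = (\<Union>i\<in>J. (\<lambda>u. (u, g i)) ` (ch i - {{}}))"
  have finE: "finite E" using F E by (auto intro: finite_subset[of _ "F \<times> F"])
  have fin_ch: "finite (ch i)" if "i \<in> I" for i using chF[OF that] F(2) by (rule finite_subset)
  have cardE: "card (E \<union> E') \<le> k + card I * d"
  proof -
    have "card E' \<le> (\<Sum>i\<in>J. card ((\<lambda>u. (u, g i)) ` (ch i - {{}})))"
      unfolding E'_def using assms(2) by (intro card_UN_le) (auto simp: J_def)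
    also have "\<dots> \<le> (\<Sum>i\<in>J. d)"
    proof (intro sum_mono)
      fix i assume "i \<in> J"
      then have i: "i \<in> I" by (simp add: J_def)
      have "card ((\<lambda>u. (u, g i)) ` (ch i - {{}})) \<le> card (ch i - {{}})"
        using fin_ch[OF i] by (intro card_image_le) auto
      also have "\<dots> \<le> card (ch i)" using fin_ch[OF i] by (intro card_mono) auto
      also have "\<dots> \<le> d" using card_ch[OF i] .
      finally show "card ((\<lambda>u. (u, g i)) ` (ch i - {{}})) \<le> d" .
    qed
    also have "\<dots> \<le> card I * d"
      using assms(2) by (simp add: J_def card_mono)
    finally show ?thesis using E(2) card_Un_le[of E E'] by linarith
  qed
  have sub: "E \<union> E' \<subseteq> {(u, v) \<in> (F \<union> g ` I) \<times> (F \<union> g ` I). u \<noteq> {} \<and> u \<subset> v}"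
  proof -
    have *: "u \<subset> g i \<and> u \<in> F" if "i \<in> J" "u \<in> ch i" for u i
    proof -
      have i: "i \<in> I" "g i \<notin> F" using that by (auto simp: J_def)
      then have "u \<in> F" "u \<subseteq> g i" using chF[OF i(1)] g[OF i(1)] that by auto
      then show ?thesis using i by blast
    qed
    have "(u, v) \<in> {(u, v) \<in> (F \<union> g ` I) \<times> (F \<union> g ` I). u \<noteq> {} \<and> u \<subset> v}"
      if "(u, v) \<in> E'" for u v
    proof -
      obtain i where i: "i \<in> J" "u \<in> ch i" "u \<noteq> {}" "v = g i" using \<open>(u, v) \<in> E'\<close> by (auto simp: E'_def)
      then have "i \<in> I" by (simp add: J_def)
      then show ?thesis using i *[OF i(1,2)] by simp
    qed
    then show ?thesis using E(1) by blast
  qed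
  have eq': "v = {} \<or> (\<exists>c. v = {c}) \<or> v = \<Union>{u. (u, v) \<in> E \<union> E'}" if v: "v \<in> F \<union> g ` I" for v
  proof (cases "v \<in> F")
    case True
    then have "{u. (u, v) \<in> E \<union> E'} = {u. (u, v) \<in> E}" unfolding E'_def J_def by blast
    then show ?thesis using eq[OF True] by simp
  next
    case False
    then obtain i where i: "i \<in> J" "v = g i" using v by (auto simp: J_def)
    have "\<Union>{u. (u, v) \<in> E \<union> E'} \<subseteq> v" using sub by blast
    moreover have "v \<subseteq> \<Union>{u. (u, v) \<in> E \<union> E'}"
    proof
      fix c assume "c \<in> v"
      then obtain u where "u \<in> ch i" "c \<in> u" using i g by (auto simp: J_def)
      then have "(u, v) \<in> E'" using i by (auto simp: E'_def)
      then show "c \<in> \<Union>{u. (u, v) \<in> E \<union> E'}" using \<open>c \<in> u\<close> by auto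
    qed
    ultimately show ?thesis by blast
  qed
  have Fn: "F \<union> g ` I \<subseteq> Pow {..<n}"
  proof -
    have "g i \<subseteq> {..<n}" if "i \<in> I" for i using chF[OF that] g[OF that] F(3) by blast
    then show ?thesis using F(3) by blast
  qed
  show ?thesis unfolding or_computable_def
  proof (intro exI conjI)
    show "g ` I \<subseteq> F \<union> g ` I" "finite (F \<union> g ` I)" "\<forall>c<n. {c} \<in> F \<union> g ` I"
      using F(2,4) assms(2) by simp_all
    show "\<forall>v\<in>F \<union> g ` I. v = {} \<or> (\<exists>c. v = {c}) \<or> v = \<Union>{u. (u, v) \<in> E \<union> E'}"
      using eq' by blast
  qed (use Fn sub cardE in simp_all)
qed

text \<open>Singletons become the inputs. The empty set has to be dropped: it would be a gate of
  in-degree zero that is not an input. As the rows are nonempty, no output is lost.\<close>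

lemma or_circuit_exists:
  assumes "or_computable n G k" and R: "\<And>r. r < m \<Longrightarrow> R r \<in> G \<and> R r \<noteq> {}"
  shows "\<exists>\<Gamma>. computes OR_gate \<Gamma> (mat m n (\<lambda>(r, c). c \<in> R r)) \<and> circuit_size \<Gamma> \<le> k"
proof -
  obtain F E where F: "G \<subseteq> F" "finite F" "F \<subseteq> Pow {..<n}" "\<And>c. c < n \<Longrightarrow> {c} \<in> F"
    and E: "E \<subseteq> {(u, v) \<in> F \<times> F. u \<noteq> {} \<and> u \<subset> v}" "card E \<le> k"
    and eq: "\<And>v. v \<in> F \<Longrightarrow> v = {} \<or> (\<exists>c. v = {c}) \<or> v = \<Union>{u. (u, v) \<in> E}"
    using assms(1) unfolding or_computable_def by auto
  obtain \<phi> :: "nat set \<Rightarrow> nat" where inj: "inj_on \<phi> F"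
    using F(2) finite_imp_inj_to_nat_seg by metis
  define \<psi> where "\<psi> = inv_into F \<phi>"
  have \<psi>: "\<psi> (\<phi> v) = v" if "v \<in> F" for v using inj that by (simp add: \<psi>_def)
  define \<Gamma> where "\<Gamma> = \<lparr>gates = \<phi> ` (F - {{}}), wires = map_prod \<phi> \<phi> ` E,
    inp = (\<lambda>c. \<phi> {c}), out = (\<lambda>r. \<phi> (R r))\<rparr>"
  have chi: "children \<Gamma> (\<phi> v) = \<phi> ` {u. (u, v) \<in> E}" if "v \<in> F" for v
    using E(1) inj that by (auto simp: children_def \<Gamma>_def inj_on_eq_iff)
  have fin: "finite E" using F E by (auto intro: finite_subset[of _ "F \<times> F"])
  \<comment> \<open>A singleton has no nonempty proper subset, and any other nonempty gate is the
    union of its children; so the childless gates are exactly the inputs.\<close>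
  have empty: "{u. (u, v) \<in> E} = {} \<longleftrightarrow> (\<exists>c. v = {c})" if "v \<in> F" "v \<noteq> {}" for v
    using eq[OF that(1)] that E(1) by (auto simp: psubset_eq subset_singleton_iff)
  have RF: "R r \<in> F - {{}}" if "r < m" for r using R[OF that] F(1) by auto
  have "wires \<Gamma> \<subseteq> measure (\<lambda>w. card (\<psi> w))"
  proof
    fix e assume "e \<in> wires \<Gamma>"
    then obtain u v where "(u, v) \<in> E" "e = (\<phi> u, \<phi> v)" by (auto simp: \<Gamma>_def)
    moreover from this have "u \<in> F" "v \<in> F" "u \<subset> v" using E(1) by auto
    moreover from this have "finite v" using F(3) by (meson PowD finite_lessThan finite_subset subsetD)
    ultimately show "e \<in> measure (\<lambda>w. card (\<psi> w))" by (simp add: \<psi> psubset_card_mono)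
  qed
  then have "acyclic (wires \<Gamma>)" by (meson wf_acyclic wf_measure wf_subset)
  moreover have "bij_betw (inp \<Gamma>) {..<n} {v \<in> gates \<Gamma>. children \<Gamma> v = {}}"
  proof -
    have "inj_on (inp \<Gamma>) {..<n}"
      using F(4) inj by (auto simp: \<Gamma>_def inj_on_def)
    moreover have "inp \<Gamma> ` {..<n} = {v \<in> gates \<Gamma>. children \<Gamma> v = {}}"
    proof (intro equalityI subsetI)
      fix w assume "w \<in> inp \<Gamma> ` {..<n}"
      then obtain c where c: "c < n" "w = \<phi> {c}" by (auto simp: \<Gamma>_def)
      then have "{u. (u, {c}) \<in> E} = {}" using empty[of "{c}"] F(4) by blast
      then show "w \<in> {v \<in> gates \<Gamma>. children \<Gamma> v = {}}"
        using c F(4) chi[of "{c}"] by (auto simp: \<Gamma>_def)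
    next
      fix w assume "w \<in> {v \<in> gates \<Gamma>. children \<Gamma> v = {}}"
      then obtain v where v: "v \<in> F" "v \<noteq> {}" "w = \<phi> v" "children \<Gamma> (\<phi> v) = {}"
        by (auto simp: \<Gamma>_def)
      then obtain c where "v = {c}" using empty[of v] chi[of v] by auto
      moreover from this have "c < n" using v F(3) by auto
      ultimately show "w \<in> inp \<Gamma> ` {..<n}" using v by (auto simp: \<Gamma>_def)
    qed
    ultimately show ?thesis by (simp add: bij_betw_def)
  qed
  ultimately have circ: "is_circuit m n \<Gamma>"
    unfolding is_circuit_def using F(2) E(1) RF by (auto simp: \<Gamma>_def)
  have "gate_forms (\<lambda>b. b) (\<lambda>g S. \<exists>u\<in>S. g u) n \<Gamma> (\<lambda>w k. k \<in> \<psi> w)"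
    unfolding gate_forms_def
  proof (intro conjI allI impI ballI)
    fix j k assume "j < n" "k < n"
    then show "(k \<in> \<psi> (inp \<Gamma> j)) = (j = k)" using F(4) by (auto simp: \<Gamma>_def \<psi>)
  next
    fix w k assume w: "w \<in> gates \<Gamma>" "children \<Gamma> w \<noteq> {}" "k < n"
    then obtain v where v: "v \<in> F" "v \<noteq> {}" "w = \<phi> v" by (auto simp: \<Gamma>_def)
    then have "v = \<Union>{u. (u, v) \<in> E}" using w eq[of v] empty[of v] chi[of v] by auto
    moreover have "\<psi> (\<phi> u) = u" if "(u, v) \<in> E" for u using E(1) that by (auto intro!: \<psi>)
    ultimately show "(k \<in> \<psi> w) = (\<exists>u\<in>children \<Gamma> w. k \<in> \<psi> u)"
      using v by (auto simp: chi \<psi>)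
  qed
  moreover have "\<psi> (out \<Gamma> r) = R r" if "r < m" for r
    using RF[OF that] by (simp add: \<Gamma>_def \<psi>)
  ultimately have "computes OR_gate \<Gamma> (mat m n (\<lambda>(r, c). c \<in> R r))"
    using circ by (auto simp: computes_over_def)
  moreover have "circuit_size \<Gamma> \<le> k"
    using E(2) card_image_le[OF fin, of "map_prod \<phi> \<phi>"] by (simp add: circuit_size_def \<Gamma>_def)
  ultimately show ?thesis by blast
qed

section \<open>The OR-circuit for the gap matrix\<close>

lemma card_digit_class:
  fixes S a :: nat
  shows "card {j. j < S * S \<and> j div S = a} \<le> S" "card {j. j < S * S \<and> j mod S = a} \<le> S"
proof -
  have eq: "j = j'" if "j div S = j' div S" "j mod S = j' mod S" for j j'
    using that by (metis div_mult_mod_eq)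
  have "card {j. j < S * S \<and> j div S = a} \<le> card {..<S}"
    by (rule card_inj_on_le[of "\<lambda>j. j mod S"])
      (auto simp: inj_on_def intro: eq intro!: mod_less_divisor gr0I)
  then show "card {j. j < S * S \<and> j div S = a} \<le> S" by simp
  have "card {j. j < S * S \<and> j mod S = a} \<le> card {..<S}"
    by (rule card_inj_on_le[of "\<lambda>j. j div S"]) (auto simp: inj_on_def less_mult_imp_div_less intro: eq)
  then show "card {j. j < S * S \<and> j mod S = a} \<le> S" by simp
qed

text \<open>This bounds the boolean rank of the off-diagonal matrix: the pairs
  \<open>a \<noteq> b\<close> are covered by \<open>2 * h\<close> rectangles, one for each bit
  position and each value of that bit in \<open>b\<close>.\<close>

lemma differing_bit:
  fixes a b :: nat
  assumes "a < 2 ^ h" "b < 2 ^ h"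
  shows "a \<noteq> b \<longleftrightarrow> (\<exists>t<h. bit b t \<noteq> bit a t)"
proof -
  have "take_bit h a = a" "take_bit h b = b" using assms by (simp_all add: take_bit_nat_eq_self)
  then have high: "bit a t \<longleftrightarrow> t < h \<and> bit a t" "bit b t \<longleftrightarrow> t < h \<and> bit b t" for t
    using bit_take_bit_iff[of h a t] bit_take_bit_iff[of h b t] by simp_all
  have "a = b" if "\<forall>t<h. bit b t = bit a t"
    using that high by (intro bit_eqI) blast
  then show ?thesis by blast
qed

text \<open>Testing the binary digits of \<open>j\<close> directly would take on the order of
  \<open>h * N * N\<close> wires, one logarithm too many. Splitting \<open>j\<close> into two
  base-\<open>S\<close> digits first avoids this.\<close>

lemma or_circuit_gap_matrix:
  assumes "h > 0" and N: "N = 4 ^ h" and "N * N < n" and M: "M \<subseteq> {..<N} \<times> {..<N}"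
  shows "\<exists>\<Gamma>. computes OR_gate \<Gamma> (gap_matrix n N M) \<and> circuit_size \<Gamma> \<le> 24 * (N * N) + 3 * n"
proof -
  \<comment> \<open>The square root of \<open>N\<close> is both the base of the digits and the
    number of subsets of a block of \<open>h\<close> columns. Factors \<open>h\<close> in the cost
    are absorbed by \<open>h * S \<le> N\<close>.\<close>
  define S :: nat where "S = 2 ^ h"
  have hS_less: "h < S" by (simp add: S_def)
  then have S: "S > 0" "h \<le> S" by auto
  have NS: "N = S * S" by (simp add: N S_def flip: power_mult_distrib)
  then have "h * S \<le> N" using S by simp
  have "S \<le> N" using S NS by simp
  then have "h \<le> N" using S by simp
  have hB: "h * (N div h + 1) \<le> 2 * N"
  proof -
    have "h * (N div h) \<le> N" by simp
    then show ?thesis using \<open>h \<le> N\<close> by (simp only: distrib_left mult_1_right)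
  qed
  have bnd: "j * N + q < n" if "j < N" "q < N" for j q
  proof -
    have "j * N + q < Suc j * N" using that by simp
    also have "\<dots> \<le> N * N" using that by (intro mult_le_mono1) simp
    finally show ?thesis using assms by simp
  qed
  define dig where "dig s j = (if s then j mod S else j div S)" for s and j :: nat
  have dig: "dig s j < S" if "j < N" for s j
    using that S NS by (auto simp: dig_def less_mult_imp_div_less)
  have card_dig: "card {j. j < N \<and> dig s j = a} \<le> S" for s a
    using card_digit_class[where S = S] NS by (cases s) (simp_all add: dig_def)
  txt \<open>
    The digits of \<open>j\<close> are first isolated (\<open>W\<close>) to keep the number of wires into the binary digit tests
    (\<open>Z\<close>) linear. \<open>T\<close> tabulates unions within a block of \<open>h\<close> columns of \<open>M\<close>, \<open>V\<close> applies \<open>M\<close>, and \<open>Y\<close>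
    collects the \<open>j\<close> having some binary digit different from that of \<open>a\<close>.
  \<close>
  define W where "W = (\<lambda>(s, a, q). {j * N + q | j. j < N \<and> dig s j = a})"
  define Z where "Z = (\<lambda>(s, t, \<beta>, q). {j * N + q | j. j < N \<and> bit (dig s j) t = \<beta>})"
  define T where "T = (\<lambda>(s, t, \<beta>, c, U). \<Union>r\<in>{r \<in> U. c * h + r < N}. Z (s, t, \<beta>, c * h + r))"
  define V where "V = (\<lambda>(s, t, \<beta>, p). {j * N + q | j q. j < N \<and> (p, q) \<in> M \<and> bit (dig s j) t = \<beta>})"
  define Y where "Y = (\<lambda>(s, a, p). {j * N + q | j q. j < N \<and> (p, q) \<in> M \<and> dig s j \<noteq> a})"
  define R where "R r = {n - 1} \<union> (if r < N * N
    then Y (False, dig False (r div N), r mod N) \<union> Y (True, dig True (r div N), r mod N) else {})" for r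
  define IW where "IW = (UNIV :: bool set) \<times> {..<S} \<times> {..<N}"
  define IZ where "IZ = (UNIV :: bool set) \<times> {..<h} \<times> (UNIV :: bool set) \<times> {..<N}"
  \<comment> \<open>The last block may be incomplete or empty; the filter in \<open>T\<close> drops
    columns beyond \<open>N\<close>.\<close>
  define IT where "IT = (UNIV :: bool set) \<times> {..<h} \<times> (UNIV :: bool set) \<times> {..N div h} \<times> Pow {..<h}"
  have cards: "card IW = 2 * S * N" "card IZ = 4 * h * N" "card IT = 4 * h * (N div h + 1) * S"
    and fin: "finite IW" "finite IZ" "finite IT"
    by (simp_all add: IW_def IZ_def IT_def card_cartesian_product card_Pow S_def algebra_simps)
  have "or_computable n (W ` IW) (0 + card IW * S)"
  proof (rule or_computable_unions[OF or_computable_singletons fin(1),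
        where ch = "\<lambda>(s, a, q). (\<lambda>j. {j * N + q}) ` {j. j < N \<and> dig s j = a}"], goal_cases)
    case (2 i)
    obtain s a q where i: "i = (s, a, q)" by (cases i)
    show ?case
      using card_image_le[of "{j. j < N \<and> dig s j = a}" "\<lambda>j. {j * N + q}"] card_dig[of s a]
      by (simp add: i)
  qed (auto simp: IW_def W_def intro!: imageI bnd)
  \<comment> \<open>The tested bit depends only on the digit, so at most \<open>S\<close> isolated
    digit values are united.\<close>
  then have "or_computable n (Z ` IZ) (0 + card IW * S + card IZ * S)"
  proof (rule or_computable_unions[OF _ fin(2),
        where ch = "\<lambda>(s, t, \<beta>, q). (\<lambda>a. W (s, a, q)) ` {a. a < S \<and> bit a t = \<beta>}"], goal_cases)
    case (2 i)
    obtain s t \<beta> q where i: "i = (s, t, \<beta>, q)" by (cases i)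
    have "card ((\<lambda>a. W (s, a, q)) ` {a. a < S \<and> bit a t = \<beta>}) \<le> card {a. a < S \<and> bit a t = \<beta>}"
      by (intro card_image_le) auto
    also have "\<dots> \<le> card {..<S}" by (intro card_mono) auto
    finally show ?case by (simp add: i)
  next
    case (3 i)
    then show ?case using dig by (fastforce simp: IZ_def Z_def W_def)
  qed (auto simp: IW_def IZ_def intro!: imageI)
  then have "or_computable n (T ` IT) (0 + card IW * S + card IZ * S + card IT * h)"
  proof (rule or_computable_unions[OF _ fin(3),
        where ch = "\<lambda>(s, t, \<beta>, c, U). (\<lambda>r. Z (s, t, \<beta>, c * h + r)) ` {r \<in> U. c * h + r < N}"], goal_cases)
    case (2 i)
    obtain s t \<beta> c U where i: "i = (s, t, \<beta>, c, U)" by (cases i)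
    have U: "U \<subseteq> {..<h}" using 2 by (auto simp: i IT_def)
    then have "card ((\<lambda>r. Z (s, t, \<beta>, c * h + r)) ` {r \<in> U. c * h + r < N}) \<le> card {r \<in> U. c * h + r < N}"
      by (intro card_image_le) (auto intro: finite_subset[of _ "{..<h}"])
    also have "\<dots> \<le> card {..<h}" using U by (intro card_mono) auto
    finally show ?case by (simp add: i)
  qed (auto simp: IT_def IZ_def T_def intro!: imageI)
  \<comment> \<open>Row \<open>p\<close> of \<open>M\<close> is cut into blocks of \<open>h\<close>
    columns, and one table entry is read per block.\<close>
  then have "or_computable n (V ` IZ)
      (0 + card IW * S + card IZ * S + card IT * h + card IZ * (N div h + 1))"
  proof (rule or_computable_unions[OF _ fin(2),
        where ch = "\<lambda>(s, t, \<beta>, p). (\<lambda>c. T (s, t, \<beta>, c, {r. r < h \<and> (p, c * h + r) \<in> M})) ` {..N div h}"], goal_cases)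
    case (2 i)
    obtain s t \<beta> p where i: "i = (s, t, \<beta>, p)" by (cases i)
    show ?case using card_image_le[of "{..N div h}" "\<lambda>c. T (s, t, \<beta>, c, {r. r < h \<and> (p, c * h + r) \<in> M})"]
      by (simp add: i)
  next
    case (3 i)
    obtain s t \<beta> p where i: "i = (s, t, \<beta>, p)" by (cases i)
    have "V (s, t, \<beta>, p) \<subseteq> (\<Union>c\<in>{..N div h}. T (s, t, \<beta>, c, {r. r < h \<and> (p, c * h + r) \<in> M}))"
    proof
      fix x assume "x \<in> V (s, t, \<beta>, p)"
      then obtain j q where jq: "x = j * N + q" "j < N" "(p, q) \<in> M" "bit (dig s j) t = \<beta>"
        by (auto simp: V_def)
      have "q < N" using jq M by auto
      then have "q div h \<le> N div h" "q div h * h + q mod h = q" "q mod h < h"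
        using assms(1) by (auto intro: div_le_mono)
      then show "x \<in> (\<Union>c\<in>{..N div h}. T (s, t, \<beta>, c, {r. r < h \<and> (p, c * h + r) \<in> M}))"
        using jq \<open>q < N\<close> by (intro UN_I[of "q div h"]) (auto simp: T_def Z_def intro!: bexI[of _ "q mod h"])
    qed
    moreover have "T (s, t, \<beta>, c, {r. r < h \<and> (p, c * h + r) \<in> M}) \<subseteq> V (s, t, \<beta>, p)" for c
      by (auto simp: T_def Z_def V_def)
    ultimately show ?case by (auto simp: i)
  qed (auto simp: IT_def IZ_def intro!: imageI)
  then have "or_computable n (Y ` IW)
      (0 + card IW * S + card IZ * S + card IT * h + card IZ * (N div h + 1) + card IW * h)"
  proof (rule or_computable_unions[OF _ fin(1),
        where ch = "\<lambda>(s, a, p). (\<lambda>t. V (s, t, \<not> bit a t, p)) ` {..<h}"], goal_cases)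
    case (2 i)
    obtain s a p where i: "i = (s, a, p)" by (cases i)
    show ?case using card_image_le[of "{..<h}" "\<lambda>t. V (s, t, \<not> bit a t, p)"]
      by (simp add: i)
  next
    case (3 i)
    obtain s a p where i: "i = (s, a, p)" by (cases i)
    have "a < S" using 3 by (auto simp: i IW_def)
    then have "dig s j \<noteq> a \<longleftrightarrow> (\<exists>t<h. bit (dig s j) t = (\<not> bit a t))" if "j < N" for j
      using differing_bit[of "dig s j" h a] dig[OF that, of s] unfolding S_def by auto
    then show ?case unfolding i by (fastforce simp: Y_def V_def)
  qed (auto simp: IW_def IZ_def intro!: imageI)
  \<comment> \<open>Two indices differ iff one of their two digits does; the third child supplies
    the all-ones last column.\<close>
  then have comp: "or_computable n (R ` {..<n})
      (0 + card IW * S + card IZ * S + card IT * h + card IZ * (N div h + 1) + card IW * h + card {..<n} * 3)"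
  proof (rule or_computable_unions[where ch = "\<lambda>r. {{n - 1}} \<union> (if r < N * N
      then {Y (False, dig False (r div N), r mod N), Y (True, dig True (r div N), r mod N)} else {})"], goal_cases)
    case (2 r)
    have "Y (s, dig s (r div N), r mod N) \<in> Y ` IW" if "r < N * N" for s
    proof -
      have "r div N < N" "r mod N < N" using that by (auto simp: less_mult_imp_div_less intro!: mod_less_divisor gr0I)
      then show ?thesis using dig by (auto simp: IW_def)
    qed
    then show ?case using 2 by auto
  next
    case (3 r)
    show ?case by (auto intro: order_trans[OF card_insert_le_m1] simp: card_insert_if)
  qed (auto simp: R_def)
  have R_iff: "c \<in> R r \<longleftrightarrow> c = n - 1 \<or>
     r < N * N \<and> c < N * N \<and> r div N \<noteq> c div N \<and> (r mod N, c mod N) \<in> M" for r c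
  proof -
    have dig_eq: "i = j \<longleftrightarrow> dig False i = dig False j \<and> dig True i = dig True j" for i j
      by (auto simp: dig_def) (metis div_mult_mod_eq)
    have "c \<in> Y (s, a, p) \<longleftrightarrow> c < N * N \<and> (p, c mod N) \<in> M \<and> dig s (c div N) \<noteq> a" for s a p
    proof
      assume "c \<in> Y (s, a, p)"
      then obtain j q where jq: "c = j * N + q" "j < N" "(p, q) \<in> M" "dig s j \<noteq> a"
        by (auto simp: Y_def)
      have "q < N" using jq M by auto
      moreover have "c < Suc j * N" using jq \<open>q < N\<close> by simp
      moreover have "Suc j * N \<le> N * N" using jq by (intro mult_le_mono1) simp
      ultimately show "c < N * N \<and> (p, c mod N) \<in> M \<and> dig s (c div N) \<noteq> a"
        using jq by auto
    next
      assume "c < N * N \<and> (p, c mod N) \<in> M \<and> dig s (c div N) \<noteq> a"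
      moreover from this have "c div N < N" by (simp add: less_mult_imp_div_less)
      moreover have "c = (c div N) * N + c mod N" by simp
      ultimately show "c \<in> Y (s, a, p)" unfolding Y_def by blast
    qed
    then show ?thesis using dig_eq[of "c div N" "r div N"] by (auto simp: R_def)
  qed
  have "gap_matrix n N M = mat n n (\<lambda>(r, c). c \<in> R r)"
    by (simp add: gap_matrix_def R_iff)
  \<comment> \<open>The layers contribute at most 2, 4, 8, 8 and 2 times \<open>N * N\<close> wires,
    and each output 3.\<close>
  moreover have "0 + card IW * S + card IZ * S + card IT * h + card IZ * (N div h + 1) + card IW * h + card {..<n} * 3
    \<le> 24 * (N * N) + 3 * n"
  proof -
    have "card IW * S = 2 * (N * N)" using NS by (simp add: cards)
    moreover have "card IZ * S \<le> 4 * (N * N)"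
      using mult_le_mono1[OF \<open>h * S \<le> N\<close>, of "4 * N"] by (simp add: cards algebra_simps)
    moreover have "card IT * h \<le> 8 * (N * N)"
    proof -
      have "card IT * h = 4 * ((h * S) * (h * (N div h + 1)))" by (simp add: cards algebra_simps)
      also have "\<dots> \<le> 4 * (N * (2 * N))"
        by (rule mult_le_mono2[OF mult_le_mono[OF \<open>h * S \<le> N\<close> hB]])
      finally show ?thesis by simp
    qed
    moreover have "card IZ * (N div h + 1) \<le> 8 * (N * N)"
      using mult_le_mono1[OF hB, of "4 * N"] by (simp add: cards algebra_simps)
    moreover have "card IW * h \<le> 2 * (N * N)"
      using mult_le_mono1[OF \<open>h * S \<le> N\<close>, of "2 * N"] by (simp add: cards algebra_simps)
    ultimately show ?thesis by simp
  qed
  moreover have "R r \<in> R ` {..<n} \<and> R r \<noteq> {}" if "r < n" for r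
    using that by (auto simp: R_def)
  ultimately show ?thesis
    using or_circuit_exists[OF comp, of n R] by (auto intro: order_trans)
qed

subsection \<open>SUM-circuits\<close>

text \<open>Natural-number coefficients cannot cancel, so each form dominates the forms of its
  children.\<close>

lemma gate_form_pos_mono:
  assumes forms: "gate_forms (of_bool :: bool \<Rightarrow> nat) sum n \<Gamma> f" and circ: "is_circuit m n \<Gamma>"
    and "(v, w) \<in> (wires \<Gamma>)\<^sup>*" "k < n" "f v k > 0"
  shows "f w k > 0"
  using assms(3,5)
proof (induction rule: rtrancl_induct)
  case (step u w)
  have "w \<in> gates \<Gamma>" "u \<in> children \<Gamma> w" using step(2) circ by (auto simp: is_circuit_def children_def)
  moreover have "finite (children \<Gamma> w)"
    using circ by (auto simp: is_circuit_def children_def intro: finite_subset[of _ "gates \<Gamma>"])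
  moreover have "f w k = (\<Sum>u\<in>children \<Gamma> w. f u k)"
    using forms \<open>w \<in> gates \<Gamma>\<close> \<open>u \<in> children \<Gamma> w\<close> assms(4) unfolding gate_forms_def by blast
  ultimately show ?case using step.IH step.prems by (auto simp: sum_pos2)
qed

text \<open>Double counting. Each entry of \<open>M\<close> claims at least \<open>N - 1\<close>
  light-to-heavy wires or light outputs. Such a wire is claimed by at most \<open>K * K\<close>
  entries, and each of the at most \<open>N * N\<close> light outputs by at most \<open>K\<close>,
  which gives the two terms on the right.\<close>

lemma sum_circuit_gap_matrix_lower_bound:
  assumes comp: "computes SUM_gate \<Gamma> (gap_matrix n N M)" and n: "N * N < n"
    and M: "M \<subseteq> {..<N} \<times> {..<N}" and K: "K > 0"
    and free: "\<And>R C. R \<times> C \<subseteq> M \<Longrightarrow> card R \<le> K \<or> card C \<le> K"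
  shows "card M * (N - 1) \<le> K * K * circuit_size \<Gamma> + N * N * K"
proof -
  obtain f where circ: "is_circuit n n \<Gamma>" and forms: "gate_forms (of_bool :: bool \<Rightarrow> nat) sum n \<Gamma> f"
    and out: "\<And>r c. r < n \<Longrightarrow> c < n \<Longrightarrow> f (out \<Gamma> r) c = of_bool (gap_matrix n N M $$ (r, c))"
    using comp by (auto simp: computes_over_def gap_matrix_def)
  have idx: "i * N + p < N * N" if "i < N" "p < N" for i p
  proof -
    have "i * N + p < Suc i * N" using that by simp
    also have "\<dots> \<le> N * N" using that by (intro mult_le_mono1) simp
    finally show ?thesis .
  qed
  have idxn: "i * N + p < n" if "i < N" "p < N" for i p using idx[OF that] n by simp
  define o' where "o' i p = out \<Gamma> (i * N + p)" for i p
  have o': "f (o' i p) (j * N + q) = of_bool (i \<noteq> j \<and> (p, q) \<in> M)"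
    if "i < N" "p < N" "j < N" "q < N" for i p j q
  proof -
    have "i * N + p < N * N" "j * N + q < N * N" using that idx by simp_all
    moreover from this have "j * N + q \<noteq> n - 1" using n by linarith
    ultimately show ?thesis using that n by (simp add: o'_def out gap_matrix_def)
  qed
  have og: "o' i p \<in> gates \<Gamma>" if "i < N" "p < N" for i p
    using circ idxn[OF that] by (auto simp: o'_def is_circuit_def)
  define X where "X v = {q. q < N \<and> (\<exists>j<N. f v (j * N + q) > 0)}" for v
  define Y where "Y v = {p. p < N \<and> (\<exists>i<N. (v, o' i p) \<in> (wires \<Gamma>)\<^sup>*)}" for v
  have finX: "finite (X v)" and finY: "finite (Y v)" for v by (auto simp: X_def Y_def)
  \<comment> \<open>Without cancellation, a column of \<open>M\<close> read by \<open>v\<close>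
    reappears in every output above \<open>v\<close>.\<close>
  have rect: "Y v \<times> X v \<subseteq> M" for v
  proof clarify
    fix p q assume "p \<in> Y v" "q \<in> X v"
    then obtain i j where *: "p < N" "q < N" "i < N" "j < N" "(v, o' i p) \<in> (wires \<Gamma>)\<^sup>*" "f v (j * N + q) > 0"
      by (auto simp: X_def Y_def)
    then have "f (o' i p) (j * N + q) > 0"
      using gate_form_pos_mono[OF forms circ] idxn by blast
    then show "(p, q) \<in> M" using o' * by (auto split: if_splits)
  qed
  define light where "light v \<longleftrightarrow> card (X v) \<le> K" for v
  have heavy: "card (Y v) \<le> K" if "\<not> light v" for v
    using free[OF rect[of v]] that by (auto simp: light_def)
  have fin: "finite (gates \<Gamma>)" "finite (wires \<Gamma>)" and sub: "wires \<Gamma> \<subseteq> gates \<Gamma> \<times> gates \<Gamma>"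
    using circ by (auto simp: is_circuit_def intro: finite_subset[of _ "gates \<Gamma> \<times> gates \<Gamma>"])
  define T where "T = {(u, v) \<in> wires \<Gamma>. light u \<and> \<not> light v}"
  define L where "L = {(i, p). i < N \<and> p < N \<and> light (o' i p)}"
  have finT: "finite T" "card T \<le> circuit_size \<Gamma>"
    using fin by (auto simp: T_def circuit_size_def intro: finite_subset card_mono)
  have finL: "finite L" "card L \<le> N * N"
  proof -
    have "L \<subseteq> {..<N} \<times> {..<N}" by (auto simp: L_def)
    from finite_subset[OF this] card_mono[OF _ this]
    show "finite L" "card L \<le> N * N" by (auto simp: card_cartesian_product)
  qed
  have finM: "finite M" using M by (rule finite_subset) simp
  \<comment> \<open>What the entry \<open>(p, q)\<close> claims: the wires by which column
    \<open>q\<close> passes from a light gate to a heavy gate below row \<open>p\<close>, and the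
    light outputs of row \<open>p\<close> reading \<open>q\<close>.\<close>
  define E where "E p q = {(u, v) \<in> T. p \<in> Y v \<and> q \<in> X u}" for p q
  define Lq where "Lq p q = {(i, p') \<in> L. p' = p \<and> q \<in> X (o' i p)}" for p q
  have key: "N - 1 \<le> card (E p q) + card (Lq p q)" if pq: "(p, q) \<in> M" for p q
  proof (rule ccontr)
    assume less: "\<not> ?thesis"
    have p: "p < N" and q: "q < N" using pq M by auto
    define D where "D = fst ` E p q \<union> (\<lambda>(i, p'). o' i p) ` Lq p q"
    have finE: "finite (E p q)" "finite (Lq p q)"
      using finT(1) finL(1) by (auto simp: E_def Lq_def elim: finite_subset[rotated])
    then have "finite D" "card D \<le> card (E p q) + card (Lq p q)"
      using card_Un_le[of "fst ` E p q" "(\<lambda>(i, p'). o' i p) ` Lq p q"]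
        card_image_le[OF finE(1), of fst] card_image_le[OF finE(2), of "\<lambda>(i, p'). o' i p"]
      by (auto simp: D_def)
    \<comment> \<open>Forms are restricted to the copies of column \<open>q\<close> in the
      \<open>N\<close> blocks.\<close>
    define b where "b u = (\<lambda>j. real (f u (j * N + q)))" for u
    \<comment> \<open>Adjoining the constant form makes the entries of \<open>x\<close> sum to 0, so
      that row \<open>i\<close> of \<open>J - I\<close> evaluates to \<open>- x i\<close>. This
      extra equation is why the bound is \<open>N - 1\<close> and not \<open>N\<close>.\<close>
    define B where "B = insert (\<lambda>_. 1) (b ` D)"
    have "finite B" using \<open>finite D\<close> by (simp add: B_def)
    moreover have "card B \<le> Suc (card D)"
      unfolding B_def using \<open>finite D\<close> card_image_le[of D b] card_insert_le_m1
      by (metis (no_types) Suc_le_mono card_insert_if finite_imageI le_Suc_eq order_trans)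
    then have "card B < card {..<N}" using \<open>card D \<le> _\<close> less by simp
    ultimately obtain x where x: "\<exists>j\<in>{..<N}. x j \<noteq> 0" "\<forall>b\<in>B. (\<Sum>j<N. b j * x j) = 0"
      using underdetermined_system[of B "{..<N}"] by auto
    have sum0: "(\<Sum>j<N. x j) = 0" and D0: "\<And>u. u \<in> D \<Longrightarrow> (\<Sum>j<N. b u j * x j) = 0"
      using x(2) by (auto simp: B_def)
    have X0: "(\<Sum>j<N. b u j * x j) = 0" if "q \<notin> X u" for u
      using that q by (intro sum.neutral) (auto simp: X_def b_def)
    txt \<open>Since \<open>x\<close> annihilates the forms in \<open>D\<close>, it annihilates all heavy gates leading to row \<open>p\<close>.\<close>
    have "wf (wires \<Gamma>)" using fin circ by (auto intro: finite_acyclic_wf simp: is_circuit_def)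
    then have heavy0: "v \<in> gates \<Gamma> \<Longrightarrow> \<not> light v \<Longrightarrow> p \<in> Y v \<Longrightarrow> (\<Sum>j<N. b v j * x j) = 0" for v
    proof (induction v rule: wf_induct_rule)
      case (less v)
      \<comment> \<open>An input reads at most one column and is light because \<open>K > 0\<close>;
        so a heavy gate is a sum of children.\<close>
      have ne: "children \<Gamma> v \<noteq> {}"
      proof
        assume "children \<Gamma> v = {}"
        then have "v \<in> inp \<Gamma> ` {..<n}"
          using less.prems circ by (simp add: is_circuit_def bij_betw_def)
        then obtain c where c: "c < n" "v = inp \<Gamma> c" by auto
        have "f v k > 0 \<longleftrightarrow> k = c" if "k < n" for k
          using forms c that by (auto simp: gate_forms_def)
        then have "X v \<subseteq> {c mod N}" using idxn by (force simp: X_def)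
        then have "card (X v) \<le> 1" using card_mono[of "{c mod N}" "X v"] by simp
        then show False using less.prems K by (simp add: light_def)
      qed
      have fv: "b v j = (\<Sum>u\<in>children \<Gamma> v. b u j)" if "j < N" for j
        using forms less.prems ne idxn[OF that q] unfolding gate_forms_def b_def by simp
      have u0: "(\<Sum>j<N. b u j * x j) = 0" if u: "u \<in> children \<Gamma> v" for u
      proof -
        have uv: "(u, v) \<in> wires \<Gamma>" using u by (simp add: children_def)
        \<comment> \<open>A heavy child is covered by induction, a light child reading
          \<open>q\<close> has its wire in \<open>E p q\<close>, and any other child vanishes on
          column \<open>q\<close>.\<close>
        consider "\<not> light u" | "light u" "q \<in> X u" | "q \<notin> X u" by blast
        then show ?thesis
        proof cases
          case 1
          have "p \<in> Y u" using less.prems uv by (auto simp: Y_def intro: converse_rtrancl_into_rtrancl)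
          then show ?thesis using less.IH[OF uv] 1 uv sub by auto
        next
          case 2
          then have "(u, v) \<in> E p q" using uv less.prems by (simp add: E_def T_def)
          then have "u \<in> D" by (force simp: D_def)
          then show ?thesis by (rule D0)
        next
          case 3
          then show ?thesis by (rule X0)
        qed
      qed
      have "(\<Sum>j<N. b v j * x j) = (\<Sum>j<N. \<Sum>u\<in>children \<Gamma> v. b u j * x j)"
        by (intro sum.cong) (simp_all add: fv sum_distrib_right)
      also have "\<dots> = (\<Sum>u\<in>children \<Gamma> v. \<Sum>j<N. b u j * x j)" by (rule sum.swap)
      also have "\<dots> = 0" using u0 by simp
      finally show ?case .
    qed
    have "x i = 0" if i: "i < N" for i
    proof -
      have orth: "(\<Sum>j<N. b (o' i p) j * x j) = 0"
      proof (cases "light (o' i p) \<and> q \<in> X (o' i p)")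
        case True
        then have "(i, p) \<in> Lq p q" using i p by (simp add: Lq_def L_def)
        then have "o' i p \<in> D" by (force simp: D_def)
        then show ?thesis by (rule D0)
      next
        case False
        have "p \<in> Y (o' i p)" using i p by (auto simp: Y_def)
        with False show ?thesis using heavy0[of "o' i p"] X0 og[OF i p] by blast
      qed
      \<comment> \<open>As \<open>(p, q)\<close> lies in \<open>M\<close>, this output restricted to
        column \<open>q\<close> is row \<open>i\<close> of \<open>J - I\<close>.\<close>
      have "(\<Sum>j<N. b (o' i p) j * x j) = (\<Sum>j<N. x j - of_bool (j = i) * x j)"
        using i p q pq by (intro sum.cong) (auto simp: b_def o')
      also have "\<dots> = - x i" using i sum0 by (simp add: sum_subtractf of_bool_def if_distrib[of "\<lambda>z. z * _"] cong: if_cong)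
      finally show ?thesis using orth by simp
    qed
    then show False using x(1) by auto
  qed
  have "card M * (N - 1) = (\<Sum>(p, q)\<in>M. N - 1)" by simp
  also have "\<dots> \<le> (\<Sum>(p, q)\<in>M. card (E p q) + card (Lq p q))"
    using key by (intro sum_mono) auto
  also have "\<dots> = (\<Sum>z\<in>M. card {e \<in> T. fst z \<in> Y (snd e) \<and> snd z \<in> X (fst e)})
      + (\<Sum>z\<in>M. card {l \<in> L. snd l = fst z \<and> snd z \<in> X (o' (fst l) (snd l))})"
    unfolding sum.distrib[symmetric] E_def Lq_def
    by (intro sum.cong refl) (auto simp: case_prod_beta intro!: arg_cong2[of _ _ _ _ "(+)"] arg_cong[of _ _ card])
  also have "(\<Sum>z\<in>M. card {e \<in> T. fst z \<in> Y (snd e) \<and> snd z \<in> X (fst e)})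
      = (\<Sum>e\<in>T. card {z \<in> M. fst z \<in> Y (snd e) \<and> snd z \<in> X (fst e)})"
    using finM finT(1) by (intro sum_multicount_gen) auto
  also have "\<dots> \<le> (\<Sum>e\<in>T. K * K)"
  proof (intro sum_mono)
    fix e assume "e \<in> T"
    then have "card (Y (snd e)) \<le> K" "card (X (fst e)) \<le> K"
      using heavy by (auto simp: T_def light_def)
    \<comment> \<open>The entries claiming a wire form part of a rectangle with few rows, as its
      head is heavy, and few columns, as its tail is light.\<close>
    have "card {z \<in> M. fst z \<in> Y (snd e) \<and> snd z \<in> X (fst e)} \<le> card (Y (snd e) \<times> X (fst e))"
      using finX finY by (intro card_mono) auto
    also have "\<dots> \<le> K * K"
      using \<open>card (Y (snd e)) \<le> K\<close> \<open>card (X (fst e)) \<le> K\<close>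
      by (simp add: card_cartesian_product mult_le_mono)
    finally show "card {z \<in> M. fst z \<in> Y (snd e) \<and> snd z \<in> X (fst e)} \<le> K * K" .
  qed
  also have "\<dots> \<le> K * K * circuit_size \<Gamma>" using finT(2) by simp
  also have "(\<Sum>z\<in>M. card {l \<in> L. snd l = fst z \<and> snd z \<in> X (o' (fst l) (snd l))})
      = (\<Sum>l\<in>L. card {z \<in> M. snd l = fst z \<and> snd z \<in> X (o' (fst l) (snd l))})"
    using finM finL(1) by (intro sum_multicount_gen) auto
  also have "\<dots> \<le> (\<Sum>l\<in>L. K)"
  proof (intro sum_mono)
    fix l assume "l \<in> L"
    have "card {z \<in> M. snd l = fst z \<and> snd z \<in> X (o' (fst l) (snd l))}
        \<le> card ({snd l} \<times> X (o' (fst l) (snd l)))"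
      using finX by (intro card_mono) auto
    also have "\<dots> \<le> K" using \<open>l \<in> L\<close> by (auto simp: L_def light_def card_cartesian_product)
    finally show "card {z \<in> M. snd l = fst z \<and> snd z \<in> X (o' (fst l) (snd l))} \<le> K" .
  qed
  also have "\<dots> \<le> N * N * K" using finL(2) by simp
  finally show ?thesis by simp
qed

subsection \<open>The gap\<close>

lemma complexity_le: "computes X \<Gamma> A \<Longrightarrow> complexity X A \<le> circuit_size \<Gamma>"
  unfolding complexity_def by (rule Least_le) blast

lemma complexity_attained:
  assumes "computable X A"
  shows "\<exists>\<Gamma>. computes X \<Gamma> A \<and> circuit_size \<Gamma> = complexity X A"
  unfolding complexity_def by (rule LeastI_ex) (use assms in \<open>auto simp: computable_def\<close>)

lemma finite_bool_mats: "finite (carrier_mat n m :: bool mat set)"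
proof -
  have "A \<in> (\<lambda>P. mat n m (\<lambda>ij. ij \<in> P)) ` Pow ({..<n} \<times> {..<m})"
    if "A \<in> carrier_mat n m" for A :: "bool mat"
    using that by (intro image_eqI[of _ _ "{(i, j). i < n \<and> j < m \<and> A $$ (i, j)}"]) auto
  then have "carrier_mat n m \<subseteq> (\<lambda>P. mat n m (\<lambda>ij. ij \<in> P)) ` Pow ({..<n} \<times> {..<m})" by blast
  then show ?thesis by (rule finite_subset) simp
qed

lemma Gap_ge:
  assumes "A \<in> carrier_mat n n" "computable X A" "computable Y A" "complexity Y A > 0"
  shows "real (complexity X A) / real (complexity Y A) \<le> Gap X Y n"
  unfolding Gap_def
proof (rule Max_ge)
  show "finite {real (complexity X A) / real (complexity Y A) | A.
     A \<in> carrier_mat n n \<and> computable X A \<and> computable Y A \<and> complexity Y A > 0}"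
    by (rule finite_subset[OF _ finite_imageI[OF finite_bool_mats[of n n],
          of "\<lambda>A. real (complexity X A) / real (complexity Y A)"]]) auto
qed (use assms in blast)

text \<open>One gate per row is fed directly by the inputs of its ones. A zero row would leave its
  gate childless, which only inputs may be.\<close>

lemma SUM_computable:
  assumes rows: "\<And>i. i < dim_row A \<Longrightarrow> \<exists>j<dim_col A. A $$ (i, j)"
  shows "computable SUM_gate A"
proof -
  define n where "n = dim_col A"
  define m where "m = dim_row A"
  define \<Gamma> where "\<Gamma> = \<lparr>gates = {..<n + m}, wires = {(j, v). j < n \<and> n \<le> v \<and> v < n + m \<and> A $$ (v - n, j)},
    inp = (\<lambda>j. j), out = (\<lambda>i. n + i)\<rparr>"
  have chi: "children \<Gamma> v = (if n \<le> v \<and> v < n + m then {j. j < n \<and> A $$ (v - n, j)} else {})" for v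
    by (auto simp: children_def \<Gamma>_def)
  have ne: "children \<Gamma> v = {} \<longleftrightarrow> v < n" if "v < n + m" for v
    using that rows[of "v - n"] by (auto simp: chi n_def m_def)
  have "wires \<Gamma> \<subseteq> less_than" by (auto simp: \<Gamma>_def)
  then have "acyclic (wires \<Gamma>)" by (meson wf_acyclic wf_less_than wf_subset)
  moreover have "{v \<in> gates \<Gamma>. children \<Gamma> v = {}} = {..<n}"
  proof -
    have "v \<in> gates \<Gamma> \<and> children \<Gamma> v = {} \<longleftrightarrow> v < n" for v
    proof (cases "v < n + m")
      case True
      then have "v \<in> gates \<Gamma>" by (simp add: \<Gamma>_def)
      with ne[OF True] show ?thesis by blast
    next
      case False
      then show ?thesis by (simp add: \<Gamma>_def)
    qed
    then show ?thesis by blast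
  qed
  ultimately have circ: "is_circuit m n \<Gamma>"
    unfolding is_circuit_def by (simp add: bij_betw_def) (auto simp: \<Gamma>_def)
  define f :: "nat \<Rightarrow> nat \<Rightarrow> nat" where "f v k = of_bool (if v < n then v = k else A $$ (v - n, k))" for v k
  have "gate_forms of_bool sum n \<Gamma> f"
    unfolding gate_forms_def
  proof (intro conjI allI impI ballI)
    fix v k assume v: "v \<in> gates \<Gamma>" "children \<Gamma> v \<noteq> {}" "k < n"
    then have nv: "n \<le> v" "v < n + m" using ne by (auto simp: \<Gamma>_def)
    have "(\<Sum>u\<in>children \<Gamma> v. f u k) = (\<Sum>u\<in>{j. j < n \<and> A $$ (v - n, j)}. if u = k then 1 else 0)"
      using nv by (intro sum.cong) (auto simp: chi f_def)
    also have "\<dots> = f v k" using v(3) nv by (simp add: f_def)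
    finally show "f v k = (\<Sum>u\<in>children \<Gamma> v. f u k)" by simp
  qed (simp add: \<Gamma>_def f_def)
  then have "computes SUM_gate \<Gamma> A"
    using circ unfolding computes.simps computes_over_def n_def[symmetric] m_def[symmetric]
    by (intro conjI exI[of _ f]) (auto simp: f_def \<Gamma>_def)
  then show ?thesis by (auto simp: computable_def)
qed

text \<open>Without wires every output is an input, whose form has a single nonzero
  coefficient.\<close>

lemma OR_complexity_pos:
  assumes "computable OR_gate A" "i < dim_row A" "j < dim_col A" "k < dim_col A" "j \<noteq> k"
    "A $$ (i, j)" "A $$ (i, k)"
  shows "complexity OR_gate A > 0"
proof (rule ccontr)
  assume "\<not> ?thesis"
  with complexity_attained[OF assms(1)] obtain \<Gamma> f where
    size: "circuit_size \<Gamma> = 0" and circ: "is_circuit (dim_row A) (dim_col A) \<Gamma>"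
    and forms: "gate_forms (\<lambda>b. b) (\<lambda>g S. \<exists>u\<in>S. g u) (dim_col A) \<Gamma> f"
    and out: "\<forall>i<dim_row A. \<forall>j<dim_col A. f (out \<Gamma> i) j = A $$ (i, j)"
    by (auto simp: computes_over_def)
  have "finite (wires \<Gamma>)"
    using circ by (auto simp: is_circuit_def intro: finite_subset[of _ "gates \<Gamma> \<times> gates \<Gamma>"])
  then have "wires \<Gamma> = {}" using size by (simp add: circuit_size_def)
  then have "children \<Gamma> v = {}" for v by (simp add: children_def)
  moreover have "out \<Gamma> i \<in> gates \<Gamma>" using circ assms(2) by (auto simp: is_circuit_def)
  ultimately have "out \<Gamma> i \<in> inp \<Gamma> ` {..<dim_col A}"
    using circ by (simp add: is_circuit_def bij_betw_def)
  then obtain c where "c < dim_col A" "out \<Gamma> i = inp \<Gamma> c" by auto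
  then have "l = c" if "l < dim_col A" "A $$ (i, l)" for l
    using forms out assms(2) that unfolding gate_forms_def by metis
  then show False using assms by metis
qed

text \<open>With \<open>N = 4 ^ h\<close> one has \<open>n \<le> 16 * (N * N)\<close>, so the
  OR-complexity is at most \<open>72 * (N * N)\<close>. The SUM-complexity is at least
  \<open>N ^ 3 / (64 * h ^ 2)\<close>, and \<open>64 * 72 = 4608\<close>.\<close>

lemma Gap_lower_bound:
  assumes h: "h \<ge> 3" and n: "16 ^ h < n" "n \<le> 16 ^ Suc h"
  shows "Gap SUM_gate OR_gate n \<ge> 4 ^ h / (4608 * (real h)\<^sup>2)"
proof -
  define N :: nat where "N = 4 ^ h"
  have N2: "N * N = 16 ^ h" by (simp add: N_def flip: power_mult_distrib)
  have NN: "N * N < n" "n \<le> 16 * (N * N)" using n N2 by simp_all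
  \<comment> \<open>This makes the lower-order terms \<open>N * N / 2\<close> and
    \<open>4 * h * N * N\<close> together at most a quarter of \<open>N ^ 3\<close>, which leaves
    another quarter of the main term \<open>N ^ 3 / 2\<close>.\<close>
  have Nh: "16 * h + 2 \<le> N"
    using h unfolding N_def by (induction h rule: dec_induct) auto
  obtain M where M: "M \<subseteq> {..<N} \<times> {..<N}" "N * N \<le> 2 * card M"
    and free: "\<And>R C. R \<times> C \<subseteq> M \<Longrightarrow> card R \<le> 4 * h \<or> card C \<le> 4 * h"
    using exists_dense_rectangle_free[of h] h unfolding N_def by auto
  define A where "A = gap_matrix n N M"
  have A: "A \<in> carrier_mat n n" by (simp add: A_def gap_matrix_def)
  have "A $$ (i, n - 1)" if "i < n" for i using that by (simp add: A_def gap_matrix_def)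
  then have sum_comp: "computable SUM_gate A"
    using A NN by (intro SUM_computable) (auto intro!: exI[of _ "n - 1"])
  obtain \<Gamma> where \<Gamma>: "computes OR_gate \<Gamma> A" "circuit_size \<Gamma> \<le> 24 * (N * N) + 3 * n"
    using or_circuit_gap_matrix[OF _ N_def NN(1) M(1)] h unfolding A_def by auto
  then have or_comp: "computable OR_gate A" by (auto simp: computable_def)
  have or_le: "complexity OR_gate A \<le> 72 * (N * N)"
    using complexity_le[OF \<Gamma>(1)] \<Gamma>(2) NN(2) by linarith
  have or_pos: "complexity OR_gate A > 0"
  proof -
    have "card M > 0" using M(2) Nh by (auto intro!: gr0I)
    then obtain p q where pq: "(p, q) \<in> M" by (metis card.empty less_irrefl ex_in_conv surj_pair)
    then have "p < N" "q < N" using M by auto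
    have "N + q < 2 * N" using \<open>q < N\<close> by simp
    also have "\<dots> \<le> N * N" using Nh by (intro mult_le_mono1) simp
    finally have Nq: "N + q < N * N" .
    have "p < N * N" using \<open>p < N\<close> Nq by simp
    \<comment> \<open>The first entry lies in block row 0 and block column 1, off the diagonal; the
      second in the all-ones column.\<close>
    have "A $$ (p, N + q)" "A $$ (p, n - 1)"
      using \<open>p < N\<close> \<open>q < N\<close> Nq \<open>p < N * N\<close> NN(1) pq by (simp_all add: A_def gap_matrix_def)
    then show ?thesis
      using OR_complexity_pos[OF or_comp, of p "N + q" "n - 1"] A Nq \<open>p < N * N\<close> NN(1) by auto
  qed
  obtain \<Delta> where \<Delta>: "computes SUM_gate \<Delta> A" "circuit_size \<Delta> = complexity SUM_gate A"
    using complexity_attained[OF sum_comp] by blast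
  define s where "s = real (complexity SUM_gate A)"
  have "card M * (N - 1) \<le> (4 * h) * (4 * h) * complexity SUM_gate A + N * N * (4 * h)"
    using sum_circuit_gap_matrix_lower_bound[OF \<Delta>(1)[unfolded A_def] NN(1) M(1) _ free] h \<Delta>(2) by simp
  then have "real (card M * (N - 1)) \<le> real ((4 * h) * (4 * h) * complexity SUM_gate A + N * N * (4 * h))"
    using of_nat_le_iff by blast
  then have up: "real (card M) * (real N - 1) \<le> 16 * ((real h)\<^sup>2 * s) + 4 * (real N * real N * real h)"
    using Nh by (simp add: s_def of_nat_diff power2_eq_square algebra_simps)
  have lo: "real N * real N / 2 * (real N - 1) \<le> real (card M) * (real N - 1)"
  proof (rule mult_right_mono)
    have "real (N * N) \<le> real (2 * card M)" using M(2) of_nat_le_iff by blast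
    then show "real N * real N / 2 \<le> real (card M)" by simp
  qed (use Nh in simp)
  have large: "real N * real N * (16 * real h + 2) \<le> real N * real N * real N"
  proof (rule mult_left_mono)
    show "16 * real h + 2 \<le> real N" using Nh by linarith
  qed simp
  have "real N * real N * real N / 2 - real N * real N / 2
      \<le> 16 * ((real h)\<^sup>2 * s) + 4 * (real N * real N * real h)"
    using order_trans[OF lo up] by (simp add: right_diff_distrib)
  moreover have "16 * (real N * real N * real h) + 2 * (real N * real N) \<le> real N * real N * real N"
    using large by (simp add: distrib_left mult_ac)
  ultimately have "real N * real N * real N \<le> 64 * ((real h)\<^sup>2 * s)" by linarith
  then have s_ge: "real N * real N * real N / (64 * (real h)\<^sup>2) \<le> s"
    using h by (simp add: divide_simps mult.commute)
  have "4 ^ h / (4608 * (real h)\<^sup>2) = (real N * real N * real N / (64 * (real h)\<^sup>2)) / (72 * (real N * real N))"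
    using h Nh by (simp add: N_def field_simps)
  also have "\<dots> \<le> s / real (complexity OR_gate A)"
  proof (rule frac_le)
    show "real (complexity OR_gate A) \<le> 72 * (real N * real N)"
      using of_nat_mono[OF or_le, where 'a = real] by simp
  qed (use s_ge or_pos in \<open>auto simp: s_def\<close>)
  also have "\<dots> \<le> Gap SUM_gate OR_gate n"
    unfolding s_def by (rule Gap_ge[OF A sum_comp or_comp or_pos])
  finally show ?thesis .
qed

theorem theorem1:
  shows "\<exists>c::real. c > 0 \<and>
    (\<forall>\<^sub>F n in sequentially. Gap SUM_gate OR_gate n \<ge> c * (real n powr (1/2) / (log 2 (real n))\<^sup>2))"
proof (intro exI[of _ "1 / 1152"] conjI)
  show "\<forall>\<^sub>F n in sequentially.
    Gap SUM_gate OR_gate n \<ge> 1 / 1152 * (real n powr (1/2) / (log 2 (real n))\<^sup>2)"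
  proof (rule eventually_sequentiallyI)
    fix n :: nat assume n: "16 ^ 3 + 1 \<le> n"
    have ex: "\<exists>h. n \<le> 16 ^ Suc h"
      using power_gt_expt[of 16 "Suc n"] by (intro exI[of _ n]) simp
    \<comment> \<open>The unique exponent with \<open>16 ^ h < n \<le> 16 ^ Suc h\<close>; the
      threshold on \<open>n\<close> ensures \<open>h \<ge> 3\<close>.\<close>
    define h where "h = (LEAST h. n \<le> 16 ^ Suc h)"
    have le: "n \<le> 16 ^ Suc h" unfolding h_def by (rule LeastI_ex[OF ex])
    have "16 ^ 3 < (16::nat) ^ Suc h" using n le by linarith
    then have h: "h \<ge> 3" using power_less_imp_less_exp[of "16::nat" 3 "Suc h"] by simp
    then have "\<not> n \<le> 16 ^ Suc (h - 1)"
      unfolding h_def by (intro not_less_Least) simp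
    then have less: "16 ^ h < n" using h by simp
    have "real n \<le> 16 ^ Suc h" using of_nat_mono[OF le, where 'a = real] by simp
    also have "\<dots> = (4 * 4 ^ h)\<^sup>2" by (simp add: power2_eq_square flip: power_mult_distrib)
    finally have "sqrt (real n) \<le> 4 * 4 ^ h" by (rule real_le_lsqrt[rotated 1]) simp_all
    then have root: "real n powr (1/2) \<le> 4 * 4 ^ h" by (simp add: powr_half_sqrt)
    have "4 * real h = log 2 (2 ^ (4 * h))" by (simp add: log_nat_power)
    also have "(2::real) ^ (4 * h) = real (16 ^ h)" by (simp add: power_mult)
    also have "log 2 (real (16 ^ h)) \<le> log 2 (real n)"
      using less by (intro log_mono) auto
    finally have "(4 * real h)\<^sup>2 \<le> (log 2 (real n))\<^sup>2" by (intro power_mono) auto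
    \<comment> \<open>Replacing the root by \<open>4 * 4 ^ h\<close> and the logarithm by
      \<open>4 * h\<close> leaves a factor \<open>4 / 16\<close>, and
      \<open>1152 * 4 = 4608\<close>.\<close>
    then have "1 / 1152 * (real n powr (1/2) / (log 2 (real n))\<^sup>2) \<le> 1 / 1152 * (4 * 4 ^ h / (4 * real h)\<^sup>2)"
      using root h by (intro mult_left_mono frac_le) auto
    also have "\<dots> = 4 ^ h / (4608 * (real h)\<^sup>2)" by (simp add: power_mult_distrib)
    also have "\<dots> \<le> Gap SUM_gate OR_gate n" by (rule Gap_lower_bound[OF h less le])
    finally show "1 / 1152 * (real n powr (1/2) / (log 2 (real n))\<^sup>2) \<le> Gap SUM_gate OR_gate n" .
  qed
qed simp

end
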